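(* Let $k \ge 1$ be an integer and let $A: X \times Y \rightarrow \{0,1,\ldots,k\}$ be a matrix with $\mathrm{Vdim}(A) = 1$. Then $\mathrm{Pdim}^*(A) \le k+2$.
   Context: A matrix is a function $A: X \times Y \rightarrow Z$ with $Z \subseteq \mathbb{R}$ (rows indexed by $X$, columns by $Y$). A set $J \subseteq Y$ is P-shattered by $A$ if there is $\vec t: J \rightarrow \mathbb{R}$ such that for every $b: J \rightarrow \{0,1\}$ there is $x \in X$ with, for all $y \in J$, $A(x,y) \ge \vec t(y)$ iff $b(y)=1$. $J$ is V-shattered by $A$ if the same holds with a single number $t \in \mathbb{R}$ used for all $y\in J$ in place of $\vec t(y)$. $\mathrm{Pdim}(A)$ (resp. $\mathrm{Vdim}(A)$) is the largest size of a P-shattered (resp. V-shattered) set $J\subseteq Y$, or $\infty$ if such sets of unbounded size exist. The transpose $A^\top: Y \times X \rightarrow Z$ is $A^\top(y,x) = A(x,y)$, and the dual dimension is $\mathrm{Pdim}^*(A) := \mathrm{Pdim}(A^\top)$. *)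

theory Defs
  imports Complex_Main "HOL-Library.Extended_Nat"
begin

text \<open>
  A matrix with row set \<open>X\<close> and column set \<open>Y\<close> is a curried function \<open>A\<close>, only whose values on
  \<open>X \<times> Y\<close> matter. Maps \<open>J \<rightarrow> {0,1}\<close> and \<open>J \<rightarrow> \<real>\<close> are represented by total functions, whose
  values outside \<open>J\<close> are irrelevant below; \<open>True\<close> stands for \<open>1\<close>.
\<close>

definition P_shattered :: "'a set \<Rightarrow> ('a \<Rightarrow> 'b \<Rightarrow> real) \<Rightarrow> 'b set \<Rightarrow> bool" where
  "P_shattered X A J \<longleftrightarrow>
     (\<exists>t :: 'b \<Rightarrow> real. \<forall>b :: 'b \<Rightarrow> bool. \<exists>x\<in>X. \<forall>y\<in>J. A x y \<ge> t y \<longleftrightarrow> b y)"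

definition V_shattered :: "'a set \<Rightarrow> ('a \<Rightarrow> 'b \<Rightarrow> real) \<Rightarrow> 'b set \<Rightarrow> bool" where
  "V_shattered X A J \<longleftrightarrow>
     (\<exists>t :: real. \<forall>b :: 'b \<Rightarrow> bool. \<exists>x\<in>X. \<forall>y\<in>J. A x y \<ge> t \<longleftrightarrow> b y)"

text \<open>
  Every subset of a shattered set is shattered, so taking the supremum over finite sets only
  still gives \<open>\<infinity>\<close> when an infinite set is shattered. The supremum of the empty family (no
  set is shattered, which happens only for \<open>X = {}\<close>) is \<open>0\<close>.
\<close>

definition Pdim :: "'a set \<Rightarrow> 'b set \<Rightarrow> ('a \<Rightarrow> 'b \<Rightarrow> real) \<Rightarrow> enat" where
  "Pdim X Y A = (SUP J \<in> {J. J \<subseteq> Y \<and> finite J \<and> P_shattered X A J}. enat (card J))"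

definition Vdim :: "'a set \<Rightarrow> 'b set \<Rightarrow> ('a \<Rightarrow> 'b \<Rightarrow> real) \<Rightarrow> enat" where
  "Vdim X Y A = (SUP J \<in> {J. J \<subseteq> Y \<and> finite J \<and> V_shattered X A J}. enat (card J))"

definition matrix_transpose :: "('a \<Rightarrow> 'b \<Rightarrow> real) \<Rightarrow> 'b \<Rightarrow> 'a \<Rightarrow> real" where
  "matrix_transpose A = (\<lambda>y x. A x y)"

definition Pdim_dual :: "'a set \<Rightarrow> 'b set \<Rightarrow> ('a \<Rightarrow> 'b \<Rightarrow> real) \<Rightarrow> enat" where
  "Pdim_dual X Y A = Pdim Y X (matrix_transpose A)"

end

theory Submission
  imports Defs
begin

text \<open>
  Round the thresholds \<open>t x\<close> of a P-shattered set of rows up to integers \<open>s x \<in> {1..k}\<close>. Suppose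
  four distinct rows satisfy \<open>s p \<le> s i = s j \<le> s q\<close>. Shattering provides a column \<open>y\<close> realising
  the bits \<open>p, i, j, q \<mapsto> 0, 0, 1, 1\<close> and a column \<open>y'\<close> realising \<open>0, 1, 0, 1\<close>. At the common
  level \<open>s i\<close> the rows \<open>i\<close> and \<open>j\<close> show the patterns \<open>01\<close> and \<open>10\<close> on \<open>(y, y')\<close>, while \<open>p\<close> and \<open>q\<close>,
  by monotonicity in the threshold, show \<open>00\<close> and \<open>11\<close>; so \<open>{y, y'}\<close> is V-shattered. Among
  \<open>k + 3\<close> rows such a quadruple exists: set aside a row with minimal and one with maximal \<open>s\<close> and apply
  the pigeonhole principle to the remaining \<open>k + 1\<close>.
\<close>

lemma V_shattered_pairI:
  assumes "p \<in> X" "i \<in> X" "j \<in> X" "q \<in> X"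
    and "A p y < t" "A p y' < t"
    and "A i y < t" "t \<le> A i y'"
    and "t \<le> A j y" "A j y' < t"
    and "t \<le> A q y" "t \<le> A q y'"
  shows "V_shattered X A {y, y'}"
  unfolding V_shattered_def
proof (intro exI allI)
  fix b :: "'b \<Rightarrow> bool"
  let ?x = "if b y then if b y' then q else j else if b y' then i else p"
  have "?x \<in> X" "\<forall>z\<in>{y, y'}. t \<le> A ?x z \<longleftrightarrow> b z"
    using assms by (auto simp: not_le)
  then show "\<exists>x\<in>X. \<forall>z\<in>{y, y'}. t \<le> A x z \<longleftrightarrow> b z"
    by blast
qed

lemma card_le_Vdim:
  assumes "J \<subseteq> Y" "finite J" "V_shattered X A J"
  shows "enat (card J) \<le> Vdim X Y A"
  unfolding Vdim_def using assms by (intro SUP_upper) auto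

lemma Vdim_ge_2:
  assumes shattered: "\<And>b. \<exists>y\<in>Y. \<forall>x\<in>J. t x \<le> A x y \<longleftrightarrow> b x"
    and "J \<subseteq> X" and rows: "p \<in> J" "i \<in> J" "j \<in> J" "q \<in> J" and dist: "distinct [p, i, j, q]"
    and level: "t p \<le> t i" "t i = t j" "t j \<le> t q"
  shows "2 \<le> Vdim X Y A"
proof -
  obtain y where y: "y \<in> Y" "\<forall>x\<in>J. t x \<le> A x y \<longleftrightarrow> x \<in> {j, q}"
    using shattered[of "\<lambda>x. x \<in> {j, q}"] by blast
  obtain y' where y': "y' \<in> Y" "\<forall>x\<in>J. t x \<le> A x y' \<longleftrightarrow> x \<in> {i, q}"
    using shattered[of "\<lambda>x. x \<in> {i, q}"] by blast
  have vals: "A p y < t p" "A i y < t i" "t j \<le> A j y" "t q \<le> A q y"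
      "A p y' < t p" "t i \<le> A i y'" "A j y' < t j" "t q \<le> A q y'"
    using y y' rows dist by (auto simp flip: not_le)
  have "V_shattered X A {y, y'}"
    using vals level rows \<open>J \<subseteq> X\<close>
    by (intro V_shattered_pairI[of p X i j q A y "t i" y']) auto
  \<comment> \<open>Row \<open>i\<close> is below its threshold at \<open>y\<close> but not at
    \<open>y'\<close>, so the shattered pair really has size 2.\<close>
  moreover have "y \<noteq> y'"
    using vals by auto
  ultimately show ?thesis
    using card_le_Vdim[of "{y, y'}" Y X A] y(1) y'(1)
    by (simp add: numeral_eq_enat numeral_2_eq_2)
qed

lemma ex_between_equal_values:
  fixes s :: "'a \<Rightarrow> 'b::linorder"
  assumes fin: "finite J" and "finite S" and S: "s ` J \<subseteq> S" and card: "card S + 3 \<le> card J"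
  obtains p i j q where "p \<in> J" "i \<in> J" "j \<in> J" "q \<in> J" "distinct [p, i, j, q]"
    "s p \<le> s i" "s i = s j" "s j \<le> s q"
proof -
  have "J \<noteq> {}"
    using card by auto
  then obtain p where p: "p \<in> J" "\<And>x. x \<in> J \<Longrightarrow> s p \<le> s x"
    using fin by (metis arg_min_if_finite(1) arg_min_least)
  have card_p: "card (J - {p}) = card J - 1"
    using p fin by simp
  then have "card (J - {p}) \<noteq> 0"
    using card by simp
  then have "J - {p} \<noteq> {}"
    by (metis card.empty)
  moreover have "finite (s ` (J - {p}))"
    using fin by simp
  ultimately have "Max (s ` (J - {p})) \<in> s ` (J - {p})"
    by (intro Max_in) auto
  \<comment> \<open>Maximising only over \<open>J - {p}\<close> keeps \<open>q\<close> distinct from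
    \<open>p\<close> even when \<open>s\<close> is constant; \<open>i\<close> and \<open>j\<close>
    will be chosen inside this set.\<close>
  then obtain q where q: "q \<in> J - {p}" "s q = Max (s ` (J - {p}))"
    by (metis imageE)
  have q_max: "s x \<le> s q" if "x \<in> J - {p}" for x
    using that fin q(2) by simp
  have "card (J - {p} - {q}) = card J - 2"
    using card_p q(1) fin by simp
  moreover have "card (s ` (J - {p} - {q})) \<le> card S"
    using \<open>finite S\<close> S by (intro card_mono) auto
  ultimately have "\<not> inj_on s (J - {p} - {q})"
    using card by (intro pigeonhole) linarith
  then obtain i j where "i \<in> J - {p} - {q}" "j \<in> J - {p} - {q}" "i \<noteq> j" "s i = s j"
    unfolding inj_on_def by blast
  then show ?thesis
    using that[of p i j q] p q(1) q_max by auto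
qed

theorem theorem6:
  fixes X :: "'a set" and Y :: "'b set"
    and A :: "'a \<Rightarrow> 'b \<Rightarrow> real" and k :: nat
  assumes "k \<ge> 1"
    and "\<And>x y. x \<in> X \<Longrightarrow> y \<in> Y \<Longrightarrow> A x y \<in> real ` {0..k}"
    and "Vdim X Y A = 1"
  shows "Pdim_dual X Y A \<le> enat (k + 2)"
proof -
  have "card J \<le> k + 2"
    if J: "J \<subseteq> X" "finite J" and "P_shattered Y (matrix_transpose A) J" for J
  proof (rule ccontr)
    assume "\<not> card J \<le> k + 2"
    then have card_J: "k + 3 \<le> card J"
      by simp
    obtain t where t: "\<And>b. \<exists>y\<in>Y. \<forall>x\<in>J. t x \<le> A x y \<longleftrightarrow> b x"
      using \<open>P_shattered Y (matrix_transpose A) J\<close>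
      unfolding P_shattered_def matrix_transpose_def by blast
    \<comment> \<open>Entries are integers, so rounding a threshold up changes no comparison with
      them.\<close>
    define s where "s x = \<lceil>t x\<rceil>" for x
    have s_iff: "real_of_int (s x) \<le> A x y \<longleftrightarrow> t x \<le> A x y" if xy: "x \<in> J" "y \<in> Y" for x y
    proof -
      obtain n where "A x y = real n"
        using assms(2)[of x y] J(1) xy by blast
      then show ?thesis
        unfolding s_def by (metis ceiling_le_iff of_int_le_iff of_int_of_nat_eq)
    qed
    have s_shattered: "\<exists>y\<in>Y. \<forall>x\<in>J. real_of_int (s x) \<le> A x y \<longleftrightarrow> b x" for b
      using t[of b] s_iff by metis
    \<comment> \<open>The column with all bits 1 bounds each level by \<open>k\<close>. In the
      column with all bits 0, a nonnegative entry lies below the level, which excludes level 0.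
      Having \<open>k\<close> levels instead of \<open>k + 1\<close> is what yields the bound
      \<open>k + 2\<close>.\<close>
    have "s ` J \<subseteq> {1..int k}"
    proof (intro image_subsetI)
      fix x assume x: "x \<in> J"
      obtain y where y: "y \<in> Y" "real_of_int (s x) \<le> A x y"
        using s_shattered[of "\<lambda>_. True"] x by auto
      obtain z where z: "z \<in> Y" "\<not> real_of_int (s x) \<le> A x z"
        using s_shattered[of "\<lambda>_. False"] x by auto
      have "A x y \<in> real ` {0..k}" "A x z \<in> real ` {0..k}"
        using assms(2) J(1) x y(1) z(1) by blast+
      then have "A x y \<le> real k" "0 \<le> A x z"
        by auto
      then show "s x \<in> {1..int k}"
        using y(2) z(2) by auto
    qed
    moreover have "card {1..int k} + 3 \<le> card J"
      using card_J by simp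
    ultimately obtain p i j q where "p \<in> J" "i \<in> J" "j \<in> J" "q \<in> J" "distinct [p, i, j, q]"
        "s p \<le> s i" "s i = s j" "s j \<le> s q"
      using J(2) ex_between_equal_values[of J "{1..int k}" s] finite_atLeastAtMost_int by metis
    then have "2 \<le> Vdim X Y A"
      using Vdim_ge_2[of Y J "\<lambda>x. real_of_int (s x)" A X p i j q, OF s_shattered J(1)] by simp
    then show False
      using assms(3) by (simp add: numeral_eq_enat one_enat_def)
  qed
  then show ?thesis
    unfolding Pdim_dual_def Pdim_def by (intro SUP_least) auto
qed

end
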